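(* Let $\Omega\subseteq\mathbb{R}^n$ and $f:\Omega\to\mathbb{R}^n$ with solution map $\phi_f$, let $G\subseteq\Omega$ be forward invariant for $f$, and let $\alpha_1,\alpha_2:G\to\mathbb{R}_+$. Let $\beta:\mathbb{R}_+\times\mathbb{R}_+\to\mathbb{R}_+$ be normalized and time-invariant. If $f$ is $\beta$-stable on $G$ with respect to $\alpha_1,\alpha_2$, i.e. $\alpha_1(\phi_f(x,t))\le\beta(\alpha_2(x),t)$ for all $x\in G$ and $t\ge0$, then there exists $V:G\to\mathbb{R}_+$ such that $$\alpha_1(x)\le V(x)\le\alpha_2(x)\quad\forall x\in G,\qquad V(\phi_f(x,t))\le\beta(V(x),t)\quad\forall x\in G,\ t\ge0.$$
   Context: $\mathbb{R}_+=[0,\infty)$. For $f:\Omega\to\mathbb{R}^n$, $\phi_f$ denotes the solution map of the ODE: $\partial_t\phi_f(x,t)=f(\phi_f(x,t))$, $\phi_f(x,0)=x$. Standing assumption: $\phi_f$ is well-defined, unique (for finite-time stable systems, uniqueness may be relaxed at the origin only), jointly continuous in $(x,t)$, and satisfies $\phi_f(\phi_f(x,t),s)=\phi_f(x,t+s)$ for $t,s\ge0$. $G\subseteq\Omega$ is forward invariant for $f$ if $\phi_f(x,t)\in G$ for all $x\in G$, $t\ge 0$. $\beta:\mathbb{R}_+\times\mathbb{R}_+\to\mathbb{R}_+$ is normalized if $\beta(y,0)=y$ for all $y\ge0$; it is time-invariant if $\beta$ is continuous and for all $y,z,t_0\ge0$, $\beta(y,t_0)=\beta(z,0)$ implies $\beta(y,t_0+t)=\beta(z,t)$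 for all $t\ge0$. *)

theory Defs
  imports "HOL-Analysis.Analysis"
begin

definition solves_ode_on ::
  "'a::real_normed_vector set \<Rightarrow> ('a \<Rightarrow> 'a) \<Rightarrow> real set \<Rightarrow> (real \<Rightarrow> 'a) \<Rightarrow> bool" where
  "solves_ode_on \<Omega> f I u \<longleftrightarrow>
     (\<forall>t\<in>I. u t \<in> \<Omega> \<and> (u has_vector_derivative f (u t)) (at t within I))"

text \<open>
  Maps on \<open>\<Omega>\<close> (or on a subset of it) are total functions of which only the values on that set
  are used.  Uniqueness of forward solutions is required only up to the first time the origin is
  reached, so that systems which are finite-time stable at the origin are included; it holds in
  particular when solutions are unique everywhere.
\<close>

definition solution_map ::
  "'a::real_normed_vector set \<Rightarrow> ('a \<Rightarrow> 'a) \<Rightarrow> ('a \<Rightarrow> real \<Rightarrow> 'a) \<Rightarrow> bool" where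
  "solution_map \<Omega> f \<phi> \<longleftrightarrow>
     (\<forall>x\<in>\<Omega>. \<phi> x 0 = x \<and> solves_ode_on \<Omega> f {0..} (\<phi> x)) \<and>
     (\<forall>x\<in>\<Omega>. \<forall>T\<ge>0. \<forall>u. solves_ode_on \<Omega> f {0..T} u \<and> u 0 = x \<and> (\<forall>s\<in>{0..<T}. u s \<noteq> 0)
        \<longrightarrow> (\<forall>t\<in>{0..T}. u t = \<phi> x t)) \<and>
     continuous_on (\<Omega> \<times> {0..}) (\<lambda>(x, t). \<phi> x t) \<and>
     (\<forall>x\<in>\<Omega>. \<forall>t\<ge>0. \<forall>s\<ge>0. \<phi> (\<phi> x t) s = \<phi> x (t + s))"

definition forward_invariant :: "('a \<Rightarrow> real \<Rightarrow> 'a) \<Rightarrow> 'a set \<Rightarrow> bool" where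
  "forward_invariant \<phi> G \<longleftrightarrow> (\<forall>x\<in>G. \<forall>t\<ge>0. \<phi> x t \<in> G)"

definition normalized :: "(real \<Rightarrow> real \<Rightarrow> real) \<Rightarrow> bool" where
  "normalized \<beta> \<longleftrightarrow> (\<forall>y\<ge>0. \<beta> y 0 = y)"

definition time_invariant :: "(real \<Rightarrow> real \<Rightarrow> real) \<Rightarrow> bool" where
  "time_invariant \<beta> \<longleftrightarrow>
     continuous_on ({0..} \<times> {0..}) (\<lambda>(y, t). \<beta> y t) \<and>
     (\<forall>y\<ge>0. \<forall>z\<ge>0. \<forall>t\<^sub>0\<ge>0. \<beta> y t\<^sub>0 = \<beta> z 0 \<longrightarrow> (\<forall>t\<ge>0. \<beta> y (t\<^sub>0 + t) = \<beta> z t))"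

definition beta_stable ::
  "('a \<Rightarrow> real \<Rightarrow> 'a) \<Rightarrow> (real \<Rightarrow> real \<Rightarrow> real) \<Rightarrow> 'a set \<Rightarrow> ('a \<Rightarrow> real) \<Rightarrow> ('a \<Rightarrow> real) \<Rightarrow> bool" where
  "beta_stable \<phi> \<beta> G \<alpha>\<^sub>1 \<alpha>\<^sub>2 \<longleftrightarrow> (\<forall>x\<in>G. \<forall>t\<ge>0. \<alpha>\<^sub>1 (\<phi> x t) \<le> \<beta> (\<alpha>\<^sub>2 x) t)"

end

theory Submission
  imports Defs
begin

text \<open>
  A normalized, time-invariant \<open>\<beta>\<close> is a continuous semiflow on the half-line, so each
  trajectory \<open>\<beta> y\<close> may be restarted at any of its values.  Call \<open>y \<ge> 0\<close> admissible for \<open>x\<close>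
  if the trajectory of \<open>\<beta>\<close> from \<open>y\<close> dominates \<open>\<alpha>\<^sub>1\<close> along the orbit of \<open>x\<close> for all times, and let
  \<open>V x\<close> be the least admissible value.  Such a minimum exists because \<open>\<beta>\<close> is continuous in its
  initial value (\<open>closed_admissible\<close>) and because stability says precisely that \<open>\<alpha>\<^sub>2 x\<close> is
  admissible; this also gives \<open>V x \<le> \<alpha>\<^sub>2 x\<close>, while domination at time \<open>0\<close> gives \<open>\<alpha>\<^sub>1 x \<le> V x\<close>.

  The decay estimate is the semigroup property on both sides: if \<open>y\<close> is admissible for \<open>x\<close>, then
  \<open>\<beta> y t\<close> is admissible for \<open>\<phi> x t\<close> (\<open>admissible_flow\<close>).  With \<open>y = V x\<close>, minimality of
  \<open>V (\<phi> x t)\<close> yields \<open>V (\<phi> x t) \<le> \<beta> (V x) t\<close>.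
\<close>

definition admissible ::
  "('a \<Rightarrow> real \<Rightarrow> 'a) \<Rightarrow> (real \<Rightarrow> real \<Rightarrow> real) \<Rightarrow> ('a \<Rightarrow> real) \<Rightarrow> 'a \<Rightarrow> real set" where
  "admissible \<phi> \<beta> \<alpha> x = {y. 0 \<le> y \<and> (\<forall>t\<ge>0. \<alpha> (\<phi> x t) \<le> \<beta> y t)}"

text \<open>
  Time-invariance restarts a trajectory at a point \<open>z\<close> with \<open>\<beta> z 0 = \<beta> y s\<close>; normalization
  says that \<open>z = \<beta> y s\<close> itself is such a point.
\<close>

lemma time_invariant_semigroup:
  assumes "normalized \<beta>" "time_invariant \<beta>"
    and "0 \<le> \<beta> y s" "0 \<le> y" "0 \<le> s" "0 \<le> t"
  shows "\<beta> (\<beta> y s) t = \<beta> y (s + t)"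
proof -
  have "\<beta> y s = \<beta> (\<beta> y s) 0"
    using assms unfolding normalized_def by simp
  then show ?thesis
    using assms unfolding time_invariant_def by metis
qed

text \<open>
  Closedness makes the infimum of the admissible values itself admissible.  Each single time
  imposes a closed condition on \<open>y\<close>, and admissibility is the intersection of these conditions.
\<close>

lemma closed_admissible:
  assumes "time_invariant \<beta>"
  shows "closed (admissible \<phi> \<beta> \<alpha> x)"
proof -
  have "closed {y \<in> {0..}. \<alpha> (\<phi> x t) \<le> \<beta> y t}" if "0 \<le> t" for t
  proof -
    have "continuous_on ({0..} \<times> {0..}) (\<lambda>(y, t). \<beta> y t)"
      using assms unfolding time_invariant_def by blast
    then have "continuous_on {0..} (\<lambda>y. (\<lambda>(y, t). \<beta> y t) (y, t))"
      by (rule continuous_on_compose2) (use that in \<open>auto intro!: continuous_intros\<close>)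
    then have "continuous_on {0..} (\<lambda>y. \<beta> y t)"
      by simp
    then show ?thesis
      by (intro continuous_on_closed_Collect_le continuous_intros closed_atLeast)
  qed
  then have "closed (\<Inter>t\<in>{0..}. {y \<in> {0..}. \<alpha> (\<phi> x t) \<le> \<beta> y t})"
    by (intro closed_INT) simp
  moreover have "admissible \<phi> \<beta> \<alpha> x = (\<Inter>t\<in>{0..}. {y \<in> {0..}. \<alpha> (\<phi> x t) \<le> \<beta> y t})"
    unfolding admissible_def by (auto dest: bspec[of _ _ 0])
  ultimately show ?thesis by simp
qed

text \<open>
  The tail after time \<open>s\<close> of the orbit of \<open>x\<close> is the orbit of \<open>\<phi> x s\<close>, and the tail of the
  dominating trajectory is the one that starts at \<open>\<beta> y s\<close>.
\<close>

lemma admissible_flow: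
  assumes "normalized \<beta>" "time_invariant \<beta>"
    and nonneg: "\<And>y t. 0 \<le> y \<Longrightarrow> 0 \<le> t \<Longrightarrow> 0 \<le> \<beta> y t"
    and flow: "\<And>t. 0 \<le> t \<Longrightarrow> \<phi> (\<phi> x s) t = \<phi> x (s + t)"
    and y: "y \<in> admissible \<phi> \<beta> \<alpha> x" and "0 \<le> s"
  shows "\<beta> y s \<in> admissible \<phi> \<beta> \<alpha> (\<phi> x s)"
proof -
  have "0 \<le> y"
    using y by (simp add: admissible_def)
  have "\<alpha> (\<phi> (\<phi> x s) t) \<le> \<beta> (\<beta> y s) t" if "0 \<le> t" for t
  proof -
    have "\<alpha> (\<phi> x (s + t)) \<le> \<beta> y (s + t)"
      using y \<open>0 \<le> s\<close> that by (simp add: admissible_def)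
    then show ?thesis
      using time_invariant_semigroup[OF assms(1,2) nonneg] flow \<open>0 \<le> y\<close> \<open>0 \<le> s\<close> that by simp
  qed
  then show ?thesis
    using nonneg \<open>0 \<le> y\<close> \<open>0 \<le> s\<close> by (simp add: admissible_def)
qed

theorem theorem17:
  fixes \<Omega> G :: "(real ^ 'n) set"
    and f :: "real ^ 'n \<Rightarrow> real ^ 'n"
    and \<phi> :: "real ^ 'n \<Rightarrow> real \<Rightarrow> real ^ 'n"
    and \<alpha>\<^sub>1 \<alpha>\<^sub>2 :: "real ^ 'n \<Rightarrow> real"
    and \<beta> :: "real \<Rightarrow> real \<Rightarrow> real"
  assumes "solution_map \<Omega> f \<phi>"
    and "G \<subseteq> \<Omega>"
    and "forward_invariant \<phi> G"
    and "\<alpha>\<^sub>1 \<in> G \<rightarrow> {0..}"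
    and "\<alpha>\<^sub>2 \<in> G \<rightarrow> {0..}"
    and "\<And>y t. y \<ge> 0 \<Longrightarrow> t \<ge> 0 \<Longrightarrow> \<beta> y t \<ge> 0"
    and "normalized \<beta>"
    and "time_invariant \<beta>"
    and "beta_stable \<phi> \<beta> G \<alpha>\<^sub>1 \<alpha>\<^sub>2"
  shows "\<exists>V :: real ^ 'n \<Rightarrow> real.
           V \<in> G \<rightarrow> {0..} \<and>
           (\<forall>x\<in>G. \<alpha>\<^sub>1 x \<le> V x \<and> V x \<le> \<alpha>\<^sub>2 x) \<and>
           (\<forall>x\<in>G. \<forall>t\<ge>0. V (\<phi> x t) \<le> \<beta> (V x) t)"
proof (intro exI conjI ballI allI impI)
  let ?A = "admissible \<phi> \<beta> \<alpha>\<^sub>1"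
  let ?V = "\<lambda>x. Inf (?A x)"
  have bdd: "bdd_below (?A x)" for x
    by (rule bdd_belowI[of _ 0]) (simp add: admissible_def)
  have \<alpha>\<^sub>2: "\<alpha>\<^sub>2 x \<in> ?A x" if "x \<in> G" for x
    using assms(5,9) that by (auto simp: admissible_def beta_stable_def)
  have V: "?V x \<in> ?A x" if "x \<in> G" for x
    using closed_contains_Inf[OF _ bdd closed_admissible[OF assms(8)]] \<alpha>\<^sub>2[OF that] by blast
  show "?V \<in> G \<rightarrow> {0..}"
    using V by (auto simp: admissible_def)
  fix x assume x: "x \<in> G"
  have "\<phi> x 0 = x"
    using assms(1,2) x by (auto simp: solution_map_def)
  moreover have "\<alpha>\<^sub>1 (\<phi> x 0) \<le> \<beta> (?V x) 0" "\<beta> (?V x) 0 = ?V x"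
    using V[OF x] assms(7) by (auto simp: admissible_def normalized_def)
  ultimately show "\<alpha>\<^sub>1 x \<le> ?V x" by simp
  show "?V x \<le> \<alpha>\<^sub>2 x"
    by (rule cInf_lower[OF \<alpha>\<^sub>2[OF x] bdd])
  fix t :: real assume t: "0 \<le> t"
  have "\<phi> (\<phi> x t) s = \<phi> x (t + s)" if "0 \<le> s" for s
    using assms(1,2) x t that by (auto simp: solution_map_def)
  then have "\<beta> (?V x) t \<in> ?A (\<phi> x t)"
    using admissible_flow[OF assms(7,8,6) _ V[OF x] t] by blast
  then show "?V (\<phi> x t) \<le> \<beta> (?V x) t"
    by (rule cInf_lower[OF _ bdd])
qed

end
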